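(* Let $q$ be a complex number with $|q|<1$. For all complex $t\ne0$ of sufficiently small modulus (depending on $q$), the generating function $G'(t,q)$ of the $q$-secant numbers is $$G'(t,q)=(1+\lambda^2)\sum\limits_{k=0}^{\infty}\dfrac{(-i\lambda\sqrt{q})^k}{1-i\lambda\sqrt{q}\,q^{k}}\,,$$ where $\lambda$ is the root of $\lambda^2-\lambda(1-q)/t+1=0$ with smallest modulus.
   Context: A Dyck path of length $2N$ is a lattice path from $(0,0)$ to $(2N,0)$ with $N$ steps $(1,1)$ and $N$ steps $(1,-1)$ that never goes below $y=0$. Its steps are labelled: $a_j$ is a step $(1,1)$ starting at height $j\ge 0$, and $b_k$ is a step $(1,-1)$ starting at height $k\ge1$. Thus a Dyck path is encoded as a word $u_1u_2\cdots u_{2N}$ in these labels. Given a possibility function $pos:\{a_0,a_1,\ldots\}\cup\{b_1,b_2,\ldots\}\to\mathbb{N}_0$, a path diagram is a Dyck path $u_1\cdots u_{2N}$ together with a sequence of integers $s_1,\ldots,s_{2N}$ with $0\le s_i\le pos(u_i)$ for all $i$. Here the possibility function is $pos(a_j)=j$ for $j\ge0$, $pos(b_k)=k-1$ for $k\ge1$. The generating function of unrestricted path diagrams is $$G'(t,q)=\sum_{N,m\ge0}b_{N,m}t^{2N}q^m,$$ where $b_{N,m}$ is the number of such path diagrams whose Dyck path has length $2N$ (no restriction on height) and with $s_1+\cdots+s_{2N}=m$ (the empty path counts once for $N=m=0$); the prime is part of the name, not a derivative. The coefficient $[t^{2N}]G'(t,q)$ is the $q$-secant number $E_{2N}(q)$.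 Here $i=\sqrt{-1}$ and $\sqrt q$ is a fixed square root of $q$. *)

theory Defs
  imports "HOL-Analysis.Analysis"
begin

text \<open>A lattice path starting at the origin is given by the list of its vertical increments:
  \<open>1\<close> stands for the step (1,1) and \<open>-1\<close> for the step (1,-1).\<close>

definition height :: "int list \<Rightarrow> nat \<Rightarrow> int" where
  "height p i = sum_list (take i p)"

definition dyck_path :: "nat \<Rightarrow> int list \<Rightarrow> bool" where
  "dyck_path N p \<longleftrightarrow>
     set p \<subseteq> {1, -1} \<and> count_list p 1 = N \<and> count_list p (-1) = N \<and>
     (\<forall>i\<le>length p. height p i \<ge> 0)"

text \<open>\<open>A j\<close> is an up-step starting at height \<open>j\<close>, \<open>B k\<close> a down-step starting at height \<open>k\<close>.
  In a Dyck path only the labels \<open>B k\<close> with \<open>k \<ge> 1\<close> occur.\<close>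

datatype label = A nat | B nat

definition step_label :: "int list \<Rightarrow> nat \<Rightarrow> label" where
  "step_label p i = (if p ! i = 1 then A (nat (height p i)) else B (nat (height p i)))"

definition path_word :: "int list \<Rightarrow> label list" where
  "path_word p = map (step_label p) [0..<length p]"

definition path_diagram :: "(label \<Rightarrow> nat) \<Rightarrow> nat \<Rightarrow> int list \<Rightarrow> nat list \<Rightarrow> bool" where
  "path_diagram pos N p s \<longleftrightarrow>
     dyck_path N p \<and> list_all2 (\<lambda>x u. x \<le> pos u) s (path_word p)"

text \<open>The truncated value at \<open>B 0\<close> is irrelevant, since this label does not occur in Dyck paths.\<close>

fun secant_pos :: "label \<Rightarrow> nat" where
  "secant_pos (A j) = j"
| "secant_pos (B k) = k - 1"

definition num_diagrams :: "nat \<Rightarrow> nat \<Rightarrow> nat" where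
  "num_diagrams N m = card {(p, s). path_diagram secant_pos N p s \<and> sum_list s = m}"

definition secant_gf_term :: "complex \<Rightarrow> complex \<Rightarrow> nat \<times> nat \<Rightarrow> complex" where
  "secant_gf_term t q = (\<lambda>(N, m). of_nat (num_diagrams N m) * t ^ (2 * N) * q ^ m)"

definition secant_gf :: "complex \<Rightarrow> complex \<Rightarrow> complex" where
  "secant_gf t q = (\<Sum>\<^sub>\<infinity>x\<in>UNIV. secant_gf_term t q x)"

end

theory Submission
  imports Defs
begin

text \<open>Let \<open>[n] = 1 + q + ... + q^(n - 1)\<close>, and let \<open>G h\<close> be the generating function, by length,
  of the path diagrams that start at height \<open>h\<close> and end at height 0. Removing the first step gives
  \<open>G h = \<delta>\<^sub>h\<^sub>0 + t ([h + 1] G (h + 1) + [h] G (h - 1))\<close>, and the factor \<open>[0] = 0\<close> enforces that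
  paths stay above the axis. As \<open>[n]\<close> is bounded, for small \<open>t\<close> this system is a contraction on
  bounded sequences, so \<open>G 0\<close> can be read off any bounded solution. With \<open>w = i \<lambda> \<surd>q\<close> and
  \<open>(a)\<^sub>n = \<Prod>j<n. 1 - a q^j\<close>, such a solution is
  \<open>F h = (1 + \<lambda>\<^sup>2) \<lambda>^h (\<Sum>k. (- w)^k (q^(k + 1))\<^sub>h / (w q^k)\<^sub>h\<^sub>+\<^sub>1)\<close>; it arises from the solution
  by powers of \<open>q^h\<close>, a \<open>2\<phi>1\<close> series, through Heine's transformation, and it is verified by creative
  telescoping. For \<open>h = 0\<close> it is the claimed series.\<close>

subsection \<open>A bounded solution of the path recurrence\<close>

definition qpoch :: "complex \<Rightarrow> complex \<Rightarrow> nat \<Rightarrow> complex" where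
  "qpoch q a n = (\<Prod>j<n. 1 - a * q ^ j)"

lemma qpoch_0 [simp]: "qpoch q a 0 = 1"
  by (simp add: qpoch_def)

lemma qpoch_Suc: "qpoch q a (Suc n) = qpoch q a n * (1 - a * q ^ n)"
  by (simp add: qpoch_def)

lemma qpoch_Suc_shift: "qpoch q a (Suc n) = (1 - a) * qpoch q (a * q) n"
  unfolding qpoch_def by (subst prod.lessThan_Suc_shift) (simp add: mult_ac)

lemma norm_mult_power_le:
  fixes a q :: "'a :: real_normed_field"
  assumes "norm a \<le> c" "norm q \<le> 1"
  shows "norm (a * q ^ n) \<le> c"
proof -
  have "norm a * norm q ^ n \<le> norm a * 1"
    using assms by (intro mult_left_mono power_le_one) auto
  then show ?thesis using assms by (simp add: norm_mult norm_power)
qed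

text \<open>Each factor has norm at most 2 here, and at least 1/2 in the companion lower bound.
  Bounds exponential in \<open>n\<close> suffice, since the resulting growth \<open>4 ^ h\<close> is
  absorbed later by \<open>l ^ h\<close> with \<open>norm l \<le> 1 / 4\<close>.\<close>

lemma norm_qpoch_le:
  assumes "norm a \<le> 1" "norm q \<le> 1"
  shows "norm (qpoch q a n) \<le> 2 ^ n"
proof (induction n)
  case (Suc n)
  have "norm (1 - a * q ^ n) \<le> 1 + 1"
    using norm_mult_power_le[OF assms] norm_triangle_ineq4[of 1 "a * q ^ n"]
    by (smt (verit) norm_one)
  then have "norm (qpoch q a n) * norm (1 - a * q ^ n) \<le> 2 ^ n * 2"
    using Suc by (intro mult_mono) auto
  then show ?case by (simp add: qpoch_Suc norm_mult mult_ac)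
qed simp

lemma norm_qpoch_ge:
  assumes "norm a \<le> 1 / 2" "norm q \<le> 1"
  shows "norm (qpoch q a n) \<ge> (1 / 2) ^ n"
proof (induction n)
  case (Suc n)
  have "norm (1 - a * q ^ n) \<ge> 1 / 2"
    using norm_mult_power_le[OF assms, of n] norm_triangle_ineq2[of 1 "a * q ^ n"] by simp
  then have "(1 / 2) ^ n * (1 / 2) \<le> norm (qpoch q a n) * norm (1 - a * q ^ n)"
    using Suc by (intro mult_mono) auto
  then show ?case by (simp add: qpoch_Suc norm_mult mult_ac)
qed simp

section \<open>The summand and its telescoping relation\<close>

definition secant_summand :: "complex \<Rightarrow> complex \<Rightarrow> nat \<Rightarrow> nat \<Rightarrow> complex" where
  "secant_summand q w h k = (- w) ^ k * qpoch q (q ^ Suc k) h / qpoch q (w * q ^ k) (Suc h)"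

text \<open>The Zeilberger certificate of \<open>secant_summand\<close>: the contiguous relation below holds termwise
  up to its forward difference in \<open>k\<close>.\<close>

definition secant_certificate :: "complex \<Rightarrow> complex \<Rightarrow> nat \<Rightarrow> nat \<Rightarrow> complex" where
  "secant_certificate q w h k =
     q ^ h * (1 - w) * ((- w) ^ k * qpoch q (q ^ k) h / qpoch q (w * q ^ k) (Suc h))"

lemma norm_qpoch_quotient_le:
  assumes "norm a \<le> 1" "norm w \<le> 1 / 2" "norm q \<le> 1"
  shows "norm ((- w) ^ k * qpoch q a h / qpoch q (w * q ^ k) (Suc h)) \<le> 2 * 4 ^ h * norm w ^ k"
proof -
  have "norm (qpoch q a h) / norm (qpoch q (w * q ^ k) (Suc h)) \<le> 2 ^ h / (1 / 2) ^ Suc h"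
    using assms by (intro frac_le norm_qpoch_le norm_qpoch_ge norm_mult_power_le) auto
  also have "\<dots> = 2 * (2 * 2) ^ h"
    unfolding power_mult_distrib by (simp add: power_divide)
  also have "(2::real) * 2 = 4" by simp
  finally have "norm w ^ k * (norm (qpoch q a h) / norm (qpoch q (w * q ^ k) (Suc h)))
      \<le> norm w ^ k * (2 * 4 ^ h)"
    by (intro mult_left_mono) auto
  then show ?thesis by (simp add: norm_mult norm_divide norm_power mult_ac)
qed

text \<open>The parameter \<open>\<mu>\<close> stands for the square of \<lambda>. All five terms
  are multiples of one common quotient of Pochhammer symbols; cancelling it leaves the polynomial
  identity \<open>key\<close>, which holds modulo \<open>w\<^sup>2 = - (\<mu> * q)\<close>.\<close>

lemma contiguous_relation:
  assumes w: "w\<^sup>2 = - (\<mu> * q)" and nz: "\<And>k. 1 - w * q ^ k \<noteq> 0"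
  shows "\<mu> * (1 - q ^ Suc (Suc h)) * secant_summand q w (Suc (Suc h)) k
      + (1 - q ^ Suc h) * secant_summand q w h k - (1 + \<mu>) * secant_summand q w (Suc h) k
    = secant_certificate q w (Suc h) (Suc k) - secant_certificate q w (Suc h) k"
proof -
  define u Q P B where "u = q ^ k" and "Q = q ^ Suc h" and "P = qpoch q (u * q) h"
    and "B = qpoch q (w * u) (Suc h)"
  define x y z where "x = 1 - w * u" and "y = 1 - w * u * Q" and "z = 1 - w * u * Q * q"
  have xyz: "x \<noteq> 0" "y \<noteq> 0" "z \<noteq> 0"
    using nz[of k] nz[of "k + Suc h"] nz[of "k + Suc (Suc h)"]
    by (simp_all add: x_def y_def z_def u_def Q_def power_add mult_ac)
  have B: "B \<noteq> 0"
    using nz by (auto simp: B_def qpoch_def u_def mult.assoc simp flip: power_add)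
  have P1: "qpoch q (u * q) (Suc h) = P * (1 - u * Q)"
    and P2: "qpoch q (u * q) (Suc (Suc h)) = P * (1 - u * Q) * (1 - u * Q * q)"
    by (simp_all add: P_def Q_def qpoch_Suc mult_ac)
  have P3: "qpoch q u (Suc h) = (1 - u) * P"
    by (simp add: P_def qpoch_Suc_shift)
  have B1: "qpoch q (w * u) (Suc (Suc h)) = B * y"
    and B2: "qpoch q (w * u) (Suc (Suc (Suc h))) = B * y * z"
    unfolding B_def Q_def y_def z_def qpoch_Suc[of q "w * u" "Suc h"]
      qpoch_Suc[of q "w * u" "Suc (Suc h)"] by (simp_all add: mult_ac)
  \<comment> \<open>The certificate at \<open>Suc k\<close> has a denominator based at
    \<open>w * u * q\<close>. Splitting off the first factor \<open>x\<close>, rather than the last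
    ones, expresses it through \<open>B\<close>.\<close>
  have "B * y * z = x * qpoch q (w * u * q) (Suc (Suc h))"
    unfolding B2[symmetric] x_def by (rule qpoch_Suc_shift)
  then have B3: "qpoch q (w * u * q) (Suc (Suc h)) = B * y * z / x"
    using xyz by simp
  have uS: "q ^ Suc k = u * q" "q ^ k = u" "q ^ Suc h = Q" "q ^ Suc (Suc h) = Q * q"
    by (simp_all add: u_def Q_def mult_ac)
  have key: "\<mu> * (1 - Q * q) * ((1 - u * Q) * (1 - u * Q * q)) + (1 - Q) * (y * z)
      - (1 + \<mu>) * ((1 - u * Q) * z) = Q * (1 - w) * (- w * ((1 - u * Q) * x) - (1 - u) * z)"
    unfolding x_def y_def z_def using w by algebra
  have "\<mu> * (1 - Q * q) * (v * (P * (1 - u * Q) * (1 - u * Q * q)) / (B * y * z))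
      + (1 - Q) * (v * P / B) - (1 + \<mu>) * (v * (P * (1 - u * Q)) / (B * y))
    = Q * (1 - w) * (- w * v * (P * (1 - u * Q)) / (B * y * z / x))
      - Q * (1 - w) * (v * ((1 - u) * P) / (B * y))" (is "?L = ?R") for v
  proof -
    have "?L = v * P / (B * y * z) * (\<mu> * (1 - Q * q) * ((1 - u * Q) * (1 - u * Q * q))
        + (1 - Q) * (y * z) - (1 + \<mu>) * ((1 - u * Q) * z))"
      using xyz B by (simp add: field_simps)
    also have "\<dots> = ?R"
      unfolding key using xyz B by (simp add: field_simps)
    finally show ?thesis .
  qed
  from this[of "(- w) ^ k"] show ?thesis
    unfolding secant_summand_def secant_certificate_def uS mult.assoc[symmetric]
    unfolding P1 P2 P3 B1 B2 B3 P_def[symmetric] B_def[symmetric]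
    by (simp add: mult.assoc)
qed

text \<open>The boundary case: a term one level below height 0 would carry the factor
  \<open>1 - q ^ 0 = 0\<close>, so only two terms remain.\<close>

lemma contiguous_relation_0:
  assumes w: "w\<^sup>2 = - (\<mu> * q)" and nz: "\<And>k. 1 - w * q ^ k \<noteq> 0"
  shows "\<mu> * (1 - q) * secant_summand q w 1 k - (1 + \<mu>) * secant_summand q w 0 k
    = secant_certificate q w 0 (Suc k) - secant_certificate q w 0 k"
proof -
  define u where "u = q ^ k"
  define x y where "x = 1 - w * u" and "y = 1 - w * u * q"
  have xy: "x \<noteq> 0" "y \<noteq> 0"
    using nz[of k] nz[of "Suc k"] by (simp_all add: x_def y_def u_def mult_ac)
  have key: "\<mu> * (1 - q) * (1 - u * q) - (1 + \<mu>) * y = (1 - w) * (- w * x - y)"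
    unfolding x_def y_def using w by algebra
  have "\<mu> * (1 - q) * (v * (1 - u * q) / (x * y)) - (1 + \<mu>) * (v / x)
      = (1 - w) * (- w * v / y) - (1 - w) * (v / x)" (is "?L = ?R") for v
  proof -
    have "?L = v / (x * y) * (\<mu> * (1 - q) * (1 - u * q) - (1 + \<mu>) * y)"
      using xy by (simp add: field_simps)
    also have "\<dots> = ?R"
      unfolding key using xy by (simp add: field_simps)
    finally show ?thesis .
  qed
  from this[of "(- w) ^ k"] show ?thesis
    unfolding secant_summand_def secant_certificate_def
    by (simp add: qpoch_def u_def x_def y_def mult_ac)
qed

section \<open>Summing the telescoping relation over \<open>k\<close>\<close>

context
  fixes q w \<mu> :: complex
  assumes q: "norm q < 1" and w_le: "norm w \<le> 1 / 2" and w: "w\<^sup>2 = - (\<mu> * q)"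
begin

lemma one_minus_w_power_nonzero: "1 - w * q ^ k \<noteq> 0"
  using norm_mult_power_le[OF w_le, of q k] q by auto

lemma norm_secant_summand_le: "norm (secant_summand q w h k) \<le> 2 * 4 ^ h * norm w ^ k"
  unfolding secant_summand_def
  using q w_le
  by (intro norm_qpoch_quotient_le) (simp_all add: norm_power power_le_one del: power_Suc)

lemma summable_w_power: "summable (\<lambda>k. c * norm w ^ k)"
  using w_le by (intro summable_mult summable_geometric) auto

lemma summable_secant_summand: "summable (secant_summand q w h)"
  by (rule summable_comparison_test'[OF summable_w_power norm_secant_summand_le])

lemma norm_suminf_secant_summand_le: "norm (suminf (secant_summand q w h)) \<le> 4 * 4 ^ h"
proof -
  have "norm (suminf (secant_summand q w h)) \<le> (\<Sum>k. 2 * 4 ^ h * norm w ^ k)"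
    by (intro norm_suminf_le norm_secant_summand_le summable_w_power)
  also have "\<dots> = 2 * 4 ^ h * (1 / (1 - norm w))"
    using w_le by (subst suminf_mult) (auto intro: summable_geometric simp: suminf_geometric)
  also have "\<dots> \<le> 2 * 4 ^ h * 2"
    using w_le by (intro mult_left_mono) (auto simp: field_simps)
  finally show ?thesis by simp
qed

lemma secant_certificate_tendsto: "secant_certificate q w h \<longlonglongrightarrow> 0"
proof -
  let ?f = "\<lambda>k. (- w) ^ k * qpoch q (q ^ k) h / qpoch q (w * q ^ k) (Suc h)"
  have lim: "(\<lambda>k. 2 * 4 ^ h * norm w ^ k) \<longlonglongrightarrow> 0"
    by (rule summable_LIMSEQ_zero[OF summable_w_power])
  have "norm (?f k) \<le> 2 * 4 ^ h * norm w ^ k" for k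
    using q w_le by (intro norm_qpoch_quotient_le) (simp_all add: norm_power power_le_one)
  then have "?f \<longlonglongrightarrow> 0"
    by (intro Lim_null_comparison[OF always_eventually[OF allI] lim])
  then show ?thesis
    unfolding secant_certificate_def by (rule tendsto_mult_right_zero)
qed

lemma suminf_secant_summand_Suc:
  "\<mu> * (1 - q ^ Suc (Suc h)) * suminf (secant_summand q w (Suc (Suc h)))
    + (1 - q ^ Suc h) * suminf (secant_summand q w h)
    = (1 + \<mu>) * suminf (secant_summand q w (Suc h))"
proof -
  have cert: "(\<lambda>k. secant_certificate q w (Suc h) (Suc k) - secant_certificate q w (Suc h) k)
      sums (0 - secant_certificate q w (Suc h) 0)"
    by (rule telescope_sums[OF secant_certificate_tendsto])
  \<comment> \<open>The numerator contains the factor \<open>1 - q ^ 0\<close>, so at positive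
    height the recurrence is homogeneous.\<close>
  have "secant_certificate q w (Suc h) 0 = 0"
    by (simp add: secant_certificate_def qpoch_Suc_shift)
  moreover have "(\<lambda>k. \<mu> * (1 - q ^ Suc (Suc h)) * secant_summand q w (Suc (Suc h)) k
      + (1 - q ^ Suc h) * secant_summand q w h k - (1 + \<mu>) * secant_summand q w (Suc h) k)
    sums (\<mu> * (1 - q ^ Suc (Suc h)) * suminf (secant_summand q w (Suc (Suc h)))
      + (1 - q ^ Suc h) * suminf (secant_summand q w h)
      - (1 + \<mu>) * suminf (secant_summand q w (Suc h)))"
    by (intro sums_add sums_diff sums_mult summable_sums summable_secant_summand)
  ultimately show ?thesis
    using sums_unique2[OF _ cert] unfolding contiguous_relation[OF w one_minus_w_power_nonzero] by force
qed

text \<open>At height 0 the numerator of the certificate is an empty product, so its value at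
  \<open>k = 0\<close> is 1. This boundary term becomes the inhomogeneity of the path recurrence,
  the contribution of the empty path.\<close>

lemma suminf_secant_summand_0:
  "\<mu> * (1 - q) * suminf (secant_summand q w 1) = (1 + \<mu>) * suminf (secant_summand q w 0) - 1"
proof -
  have cert: "(\<lambda>k. secant_certificate q w 0 (Suc k) - secant_certificate q w 0 k)
      sums (0 - secant_certificate q w 0 0)"
    by (rule telescope_sums[OF secant_certificate_tendsto])
  have "secant_certificate q w 0 0 = 1"
    using one_minus_w_power_nonzero[of 0] by (simp add: secant_certificate_def qpoch_Suc_shift)
  moreover have s: "(\<lambda>k. \<mu> * (1 - q) * secant_summand q w 1 k - (1 + \<mu>) * secant_summand q w 0 k)
    sums (\<mu> * (1 - q) * suminf (secant_summand q w 1) - (1 + \<mu>) * suminf (secant_summand q w 0))"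
    by (intro sums_diff sums_mult summable_sums summable_secant_summand)
  ultimately show ?thesis
    using sums_unique2[OF s[unfolded contiguous_relation_0[OF w one_minus_w_power_nonzero]] cert]
    by (simp add: algebra_simps)
qed

end

subsection \<open>Path diagrams and their weights\<close>

text \<open>The recursion removes the first step. A down-step from \<open>h\<close> admits the
  integers up to \<open>h - 1\<close>, that is \<open>y < h\<close>; at \<open>h = 0\<close> this
  range is empty, which keeps paths above the axis and makes the truncated \<open>h - 1\<close>
  harmless.\<close>

primrec diagrams :: "nat \<Rightarrow> nat \<Rightarrow> (int list \<times> nat list) set" where
  "diagrams 0 h = (if h = 0 then {([], [])} else {})"
| "diagrams (Suc n) h =
     (\<lambda>(y, p, s). (1 # p, y # s)) ` ({..h} \<times> diagrams n (Suc h)) \<union>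
     (\<lambda>(y, p, s). (- 1 # p, y # s)) ` ({..<h} \<times> diagrams n (h - 1))"

lemma finite_diagrams: "finite (diagrams n h)"
  by (induction n arbitrary: h) auto

lemma diagrams_odd: "odd (n + h) \<Longrightarrow> diagrams n h = {}"
  by (induction n arbitrary: h) (auto elim: oddE)

text \<open>The weight variable is kept generic because both the complex \<open>q\<close> and its
  real majorant \<open>norm q\<close> are substituted.\<close>

definition diagram_sum :: "'a :: comm_semiring_1 \<Rightarrow> nat \<Rightarrow> nat \<Rightarrow> 'a" where
  "diagram_sum x n h = (\<Sum>(p, s)\<in>diagrams n h. x ^ sum_list s)"

lemma diagram_sum_0: "diagram_sum x 0 h = of_bool (h = 0)"
  by (simp add: diagram_sum_def)

text \<open>The integer on the first step is independent of the rest, so its geometric sum factors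
  out.\<close>

lemma diagram_sum_Suc:
  "diagram_sum x (Suc n) h = (\<Sum>y\<le>h. x ^ y) * diagram_sum x n (Suc h)
     + (\<Sum>y<h. x ^ y) * diagram_sum x n (h - 1)"
proof -
  have *: "(\<Sum>(p, s)\<in>(\<lambda>(y, p, s). (e # p, y # s)) ` (Y \<times> D). x ^ sum_list s)
      = (\<Sum>y\<in>Y. x ^ y) * (\<Sum>(p, s)\<in>D. x ^ sum_list s)"
    for e :: int and Y and D :: "(int list \<times> nat list) set"
    by (subst sum.reindex)
      (auto simp: inj_on_def case_prod_unfold power_add sum_product sum.cartesian_product)
  show ?thesis
    unfolding diagram_sum_def diagrams.simps
    by (subst sum.union_disjoint) (auto simp: * finite_diagrams)
qed

text \<open>The non-recursive notion of \<open>path_diagram\<close>, relaxed to an arbitrary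
  starting height so that induction on the first step is possible; \<open>height\<close> stays
  relative to the start.\<close>

definition shifted_diagram :: "nat \<Rightarrow> int list \<Rightarrow> nat list \<Rightarrow> bool" where
  "shifted_diagram h p s \<longleftrightarrow> set p \<subseteq> {1, -1} \<and> int h + sum_list p = 0 \<and>
     (\<forall>i\<le>length p. int h + height p i \<ge> 0) \<and> length s = length p \<and>
     (\<forall>i<length p. s ! i \<le> secant_pos
        (if p ! i = 1 then A (nat (int h + height p i)) else B (nat (int h + height p i))))"

lemma all_le_Suc: "(\<forall>i\<le>Suc n. P i) \<longleftrightarrow> P 0 \<and> (\<forall>i\<le>n. P (Suc i))"
  using All_less_Suc2[of "Suc n" P] by (simp only: less_Suc_eq_le)

lemma height_0 [simp]: "height p 0 = 0"
  by (simp add: height_def)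

lemma height_Cons_Suc [simp]: "height (x # p) (Suc i) = x + height p i"
  by (simp add: height_def)

lemma shifted_diagram_Nil: "shifted_diagram h [] s \<longleftrightarrow> h = 0 \<and> s = []"
  by (auto simp: shifted_diagram_def)

lemma shifted_diagram_up:
  "shifted_diagram h (1 # p) s \<longleftrightarrow> (\<exists>y s'. s = y # s' \<and> y \<le> h \<and> shifted_diagram (Suc h) p s')"
  by (cases s) (auto simp: shifted_diagram_def all_le_Suc All_less_Suc2 algebra_simps)

lemma shifted_diagram_down:
  "shifted_diagram h (- 1 # p) s \<longleftrightarrow>
     (\<exists>y s'. s = y # s' \<and> y < h \<and> shifted_diagram (h - 1) p s')"
proof (cases h)
  case 0
  \<comment> \<open>A down-step from height 0 reaches -1, so both sides are false.\<close>
  then show ?thesis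
    by (auto simp: shifted_diagram_def all_le_Suc)
next
  case (Suc h')
  then show ?thesis
    by (cases s) (auto simp: shifted_diagram_def all_le_Suc All_less_Suc2 algebra_simps)
qed

lemma Cons_mem_diagrams:
  "(x # p, s) \<in> diagrams (Suc n) h \<longleftrightarrow> (\<exists>y s'. s = y # s' \<and>
     (x = 1 \<and> y \<le> h \<and> (p, s') \<in> diagrams n (Suc h) \<or>
      x = - 1 \<and> y < h \<and> (p, s') \<in> diagrams n (h - 1)))"
  unfolding diagrams.simps image_def by fastforce

lemma mem_diagrams_iff: "(p, s) \<in> diagrams n h \<longleftrightarrow> length p = n \<and> shifted_diagram h p s"
proof (induction n arbitrary: h p s)
  case 0
  then show ?case by (auto simp: shifted_diagram_Nil)
next
  case (Suc n)
  show ?case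
  proof (cases p)
    case Nil
    then show ?thesis by auto
  next
    case (Cons x p')
    consider "x = 1" | "x = - 1" | "x \<noteq> 1" "x \<noteq> - 1" by blast
    then show ?thesis
    proof cases
      case 1
      then show ?thesis
        using Cons by (auto simp: shifted_diagram_up Suc.IH Cons_mem_diagrams simp del: diagrams.simps)
    next
      case 2
      then show ?thesis
        using Cons by (auto simp: shifted_diagram_down Suc.IH Cons_mem_diagrams simp del: diagrams.simps)
    next
      case 3
      then show ?thesis
        using Cons by (auto simp: shifted_diagram_def Cons_mem_diagrams simp del: diagrams.simps)
    qed
  qed
qed

lemma count_pm1:
  assumes "set p \<subseteq> {1, - 1 :: int}"
  shows "int (count_list p 1) - int (count_list p (- 1)) = sum_list p"
    and "count_list p 1 + count_list p (- 1) = length p"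
  using assms by (induction p) auto

text \<open>Trades the two step counts for length and final height, the data used by
  \<open>shifted_diagram\<close>.\<close>

lemma dyck_path_iff:
  "dyck_path N p \<longleftrightarrow> set p \<subseteq> {1, -1} \<and> length p = 2 * N \<and> sum_list p = 0 \<and>
     (\<forall>i\<le>length p. height p i \<ge> 0)"
proof (cases "set p \<subseteq> {1, - 1}")
  case True
  have "count_list p 1 = N \<and> count_list p (- 1) = N \<longleftrightarrow> length p = 2 * N \<and> sum_list p = 0"
    using count_pm1[OF True] by arith
  then show ?thesis unfolding dyck_path_def by blast
qed (simp add: dyck_path_def)

lemma path_diagram_iff: "path_diagram secant_pos N p s \<longleftrightarrow> (p, s) \<in> diagrams (2 * N) 0"
  unfolding mem_diagrams_iff path_diagram_def dyck_path_iff shifted_diagram_def path_word_def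
    step_label_def[abs_def]
  by (auto simp: list_all2_conv_all_nth)

lemma num_diagrams_eq: "num_diagrams N m = card {(p, s) \<in> diagrams (2 * N) 0. sum_list s = m}"
  by (simp add: num_diagrams_def path_diagram_iff)

text \<open>There are finitely many diagrams of a given length, so the series in \<open>m\<close>
  has finite support and is the finite sum over diagrams grouped by total weight.\<close>

lemma num_diagrams_has_sum:
  fixes q :: "'a :: {comm_semiring_1, topological_comm_monoid_add}"
  shows "((\<lambda>m. of_nat (num_diagrams N m) * q ^ m) has_sum diagram_sum q (2 * N) 0) UNIV"
proof -
  let ?f = "\<lambda>m. of_nat (num_diagrams N m) * q ^ m"
  let ?wt = "\<lambda>x :: int list \<times> nat list. sum_list (snd x)"
  let ?D = "diagrams (2 * N) 0"
  let ?M = "?wt ` ?D"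
  have num: "num_diagrams N m = card {x \<in> ?D. ?wt x = m}" for m
    by (simp add: num_diagrams_eq case_prod_unfold)
  have "?f m = (\<Sum>x\<in>{x \<in> ?D. ?wt x = m}. q ^ ?wt x)" for m
  proof -
    have "(\<Sum>x\<in>{x \<in> ?D. ?wt x = m}. q ^ ?wt x) = (\<Sum>x\<in>{x \<in> ?D. ?wt x = m}. q ^ m)"
      by (rule sum.cong) auto
    then show ?thesis by (simp only: num sum_constant)
  qed
  then have "sum ?f ?M = (\<Sum>m\<in>?M. \<Sum>x\<in>{x \<in> ?D. ?wt x = m}. q ^ ?wt x)"
    by (simp only:)
  also have "\<dots> = diagram_sum q (2 * N) 0"
    unfolding diagram_sum_def case_prod_unfold
    by (rule sum.image_gen[symmetric]) (rule finite_diagrams)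
  finally have fin: "(?f has_sum diagram_sum q (2 * N) 0) ?M"
    by (rule has_sum_finiteI[OF finite_imageI[OF finite_diagrams] sym])
  have "num_diagrams N m = 0" if "m \<notin> ?M" for m
  proof -
    have "{x \<in> ?D. ?wt x = m} = {}" using that by blast
    then show ?thesis by (simp only: num card.empty)
  qed
  then have "(?f has_sum c) UNIV \<longleftrightarrow> (?f has_sum c) ?M" for c
    by (intro has_sum_cong_neutral) simp_all
  with fin show ?thesis by blast
qed

section \<open>The contraction estimate and uniqueness of bounded solutions\<close>

lemma norm_qint_le:
  fixes x :: "'a :: real_normed_field"
  assumes "norm x < 1"
  shows "norm (\<Sum>y<n. x ^ y) \<le> 1 / (1 - norm x)"
proof -
  have "norm (\<Sum>y<n. x ^ y) \<le> (\<Sum>y<n. norm x ^ y)"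
    by (intro order.trans[OF norm_sum]) (simp add: norm_power)
  also have "\<dots> \<le> (\<Sum>y. norm x ^ y)"
    using assms by (intro sum_le_suminf summable_geometric) auto
  finally show ?thesis using assms by (simp add: suminf_geometric)
qed

text \<open>Both q-integers are bounded by \<open>1 / (1 - norm x)\<close> uniformly in
  \<open>h\<close>, so one application of the recurrence scales a uniform bound by a fixed factor.
  This controls the path weights as well as the error of a bounded solution.\<close>

lemma secant_step_bound:
  fixes x a b t :: "'a :: real_normed_field"
  assumes x: "norm x < 1" and a: "norm a \<le> C" and b: "norm b \<le> C"
  shows "norm (t * ((\<Sum>y\<le>h. x ^ y) * a + (\<Sum>y<h. x ^ y) * b)) \<le> 2 * norm t / (1 - norm x) * C"
proof -
  have "C \<ge> 0" using a norm_ge_zero order.trans by blast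
  have "norm ((\<Sum>y\<le>h. x ^ y) * a + (\<Sum>y<h. x ^ y) * b)
      \<le> 1 / (1 - norm x) * C + 1 / (1 - norm x) * C"
    using norm_qint_le[OF x, of h] norm_qint_le[OF x, of "Suc h"] x a b
    by (intro norm_triangle_mono) (auto simp: norm_mult lessThan_Suc_atMost simp del: sum.lessThan_Suc
        intro!: mult_mono simp flip: times_divide_eq_left)
  then have "norm t * norm ((\<Sum>y\<le>h. x ^ y) * a + (\<Sum>y<h. x ^ y) * b)
      \<le> norm t * (1 / (1 - norm x) * C + 1 / (1 - norm x) * C)"
    by (intro mult_left_mono) auto
  then show ?thesis by (simp add: norm_mult mult_ac)
qed

lemma norm_diagram_sum_le:
  fixes x t :: "'a :: real_normed_field"
  assumes x: "norm x < 1"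
  shows "norm (t ^ n * diagram_sum x n h) \<le> (2 * norm t / (1 - norm x)) ^ n"
proof (induction n arbitrary: h)
  case (Suc n)
  have "t ^ Suc n * diagram_sum x (Suc n) h = t * ((\<Sum>y\<le>h. x ^ y) * (t ^ n * diagram_sum x n (Suc h))
     + (\<Sum>y<h. x ^ y) * (t ^ n * diagram_sum x n (h - 1)))"
    by (simp add: diagram_sum_Suc algebra_simps)
  then show ?case
    using secant_step_bound[OF x Suc.IH[of "Suc h"] Suc.IH[of "h - 1"], of t h] by (simp only: power_Suc)
qed (simp add: diagram_sum_0)

text \<open>The partial sums are the iterates of the recurrence started at 0. Their distance to
  \<open>F\<close> obeys the homogeneous recurrence, so it starts below \<open>C\<close> and gains a
  factor \<open>\<rho>\<close> with every further path length.\<close>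

lemma bounded_solution_sums:
  fixes x t :: "'a :: {real_normed_field, banach}" and F :: "nat \<Rightarrow> 'a"
  assumes x: "norm x < 1" and t: "2 * norm t / (1 - norm x) < 1"
    and F: "\<And>h. F h = of_bool (h = 0)
      + t * ((\<Sum>y\<le>h. x ^ y) * F (Suc h) + (\<Sum>y<h. x ^ y) * F (h - 1))"
    and C: "\<And>h. norm (F h) \<le> C"
  shows "(\<lambda>n. t ^ n * diagram_sum x n h) sums F h"
proof -
  define \<rho> where "\<rho> = 2 * norm t / (1 - norm x)"
  have \<rho>: "0 \<le> \<rho>" "\<rho> < 1" using x t by (auto simp: \<rho>_def)
  have *: "norm (F h - (\<Sum>n<m. t ^ n * diagram_sum x n h)) \<le> \<rho> ^ m * C" for m h
  proof (induction m arbitrary: h)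
    case 0
    then show ?case by (simp add: C)
  next
    case (Suc m)
    let ?E = "\<lambda>h. F h - (\<Sum>n<m. t ^ n * diagram_sum x n h)"
    have "(\<Sum>n<Suc m. t ^ n * diagram_sum x n h) = of_bool (h = 0)
       + t * ((\<Sum>y\<le>h. x ^ y) * (\<Sum>n<m. t ^ n * diagram_sum x n (Suc h))
       + (\<Sum>y<h. x ^ y) * (\<Sum>n<m. t ^ n * diagram_sum x n (h - 1)))"
      by (subst sum.lessThan_Suc_shift)
        (simp add: diagram_sum_0 diagram_sum_Suc sum_distrib_left sum.distrib algebra_simps)
    then have "F h - (\<Sum>n<Suc m. t ^ n * diagram_sum x n h)
       = t * ((\<Sum>y\<le>h. x ^ y) * ?E (Suc h) + (\<Sum>y<h. x ^ y) * ?E (h - 1))"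
      by (subst F) (simp add: algebra_simps)
    then show ?case
      using secant_step_bound[OF x Suc.IH[of "Suc h"] Suc.IH[of "h - 1"], of t h]
      by (simp add: \<rho>_def)
  qed
  have "(\<lambda>m. \<rho> ^ m * C) \<longlonglongrightarrow> 0"
    using \<rho> by (intro tendsto_mult_left_zero LIMSEQ_power_zero) auto
  then have "(\<lambda>m. F h - (\<Sum>n<m. t ^ n * diagram_sum x n h)) \<longlonglongrightarrow> 0"
    by (rule Lim_null_comparison[rotated]) (use * in auto)
  then have "(\<lambda>m. F h - (F h - (\<Sum>n<m. t ^ n * diagram_sum x n h))) \<longlonglongrightarrow> F h - 0"
    by (intro tendsto_intros)
  then show ?thesis by (simp add: sums_def)
qed

subsection \<open>The generating function\<close>

text \<open>Absolute convergence of the double series follows by replacing \<open>t\<close> and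
  \<open>q\<close> with their norms: the inner sums are then real path weights with a geometric
  majorant. This justifies evaluating the double series as an iterated sum.\<close>

lemma secant_gf_has_sum:
  assumes q: "norm q < 1" and t: "2 * norm t / (1 - norm q) < 1"
    and S: "(\<lambda>n. t ^ n * diagram_sum q n 0) sums S"
  shows "(secant_gf_term t q has_sum S) UNIV"
proof -
  let ?\<rho> = "2 * norm t / (1 - norm q)"
  let ?g = "\<lambda>N. t ^ (2 * N) * diagram_sum q (2 * N) 0"
  let ?G = "\<lambda>N. norm t ^ (2 * N) * diagram_sum (norm q) (2 * N) 0"
  have \<rho>: "0 \<le> ?\<rho>" "?\<rho>\<^sup>2 < 1" using q t by (simp_all add: power_less_one_iff)
  have geom: "summable (\<lambda>N. (?\<rho>\<^sup>2) ^ N)"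
    using \<rho> by (intro summable_geometric) simp
  have "norm (norm (?G N)) \<le> (?\<rho>\<^sup>2) ^ N" for N
    using norm_diagram_sum_le[of "norm q" "norm t" "2 * N" 0] q by (simp add: power_mult)
  then have "?G summable_on UNIV"
    by (intro norm_summable_imp_summable_on summable_comparison_test'[OF geom])
  moreover have "((\<lambda>m. norm (secant_gf_term t q (N, m))) has_sum ?G N) UNIV" for N
    using has_sum_cmult_right[OF num_diagrams_has_sum[of N "norm q"], of "norm t ^ (2 * N)"]
    by (simp add: secant_gf_term_def norm_mult norm_power mult_ac)
  ultimately have "(\<lambda>x. norm (secant_gf_term t q x)) summable_on Sigma UNIV (\<lambda>_. UNIV)"
    by (intro summable_on_SigmaI) auto
  then have summable: "secant_gf_term t q summable_on Sigma UNIV (\<lambda>_. UNIV)"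
    by (rule abs_summable_summable)
  \<comment> \<open>Paths from height 0 to height 0 have even length, so only the terms with index
    \<open>2 * N\<close> survive.\<close>
  have "diagram_sum q n 0 = 0" if "n \<notin> range ((*) 2)" for n
  proof -
    have "odd n" using that by (auto elim: evenE)
    then show ?thesis by (simp add: diagram_sum_def diagrams_odd)
  qed
  then have "?g sums S"
    using S sums_mono_reindex[of "(*) 2" "\<lambda>n. t ^ n * diagram_sum q n 0" S]
    by (simp add: strict_mono_def)
  moreover have "norm (norm (?g N)) \<le> (?\<rho>\<^sup>2) ^ N" for N
    using norm_diagram_sum_le[OF q, of t "2 * N" 0] by (simp add: power_mult)
  then have "summable (\<lambda>N. norm (?g N))"
    by (intro summable_comparison_test'[OF geom])
  ultimately have "(?g has_sum S) UNIV"
    by (intro norm_summable_imp_has_sum)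
  moreover have "((\<lambda>m. secant_gf_term t q (N, m)) has_sum ?g N) UNIV" for N
    using has_sum_cmult_right[OF num_diagrams_has_sum[of N q], of "t ^ (2 * N)"]
    by (simp add: secant_gf_term_def mult_ac)
  ultimately have "(secant_gf_term t q has_sum S) (Sigma UNIV (\<lambda>_. UNIV))"
    using summable by (intro has_sum_SigmaI) auto
  then show ?thesis by simp
qed

lemma secant_sums:
  fixes q t l w :: complex
  assumes q: "norm q < 1" and t: "2 * norm t / (1 - norm q) < 1"
    and l: "norm l \<le> 1 / 4" "t * (1 + l\<^sup>2) = l * (1 - q)"
    and w: "norm w \<le> 1 / 2" "w\<^sup>2 = - (l\<^sup>2 * q)"
  shows "(\<lambda>n. t ^ n * diagram_sum q n 0) sums ((1 + l\<^sup>2) * suminf (secant_summand q w 0))"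
proof -
  define S where "S h = suminf (secant_summand q w h)" for h
  define F where "F h = (1 + l\<^sup>2) * l ^ h * S h" for h
  have q1: "q \<noteq> 1" using q by auto
  \<comment> \<open>The quadratic equation for \<open>l\<close> cancels the denominator of the
    q-integer. The path recurrence for \<open>F\<close> thereby becomes the recurrence for
    \<open>S\<close> with \<open>\<mu> = l\<^sup>2\<close>.\<close>
  have step: "t * ((\<Sum>y<n. q ^ y) * F h) = l * (1 - q ^ n) * l ^ h * S h" for n h
  proof -
    have "t * ((\<Sum>y<n. q ^ y) * F h) = (t * (1 + l\<^sup>2)) * (\<Sum>y<n. q ^ y) * l ^ h * S h"
      by (simp add: F_def)
    also have "\<dots> = l * ((1 - q) * (\<Sum>y<n. q ^ y)) * l ^ h * S h"
      by (simp only: l mult_ac)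
    finally show ?thesis by (simp only: one_diff_power_eq[symmetric])
  qed
  have rec: "F h = of_bool (h = 0)
      + t * ((\<Sum>y\<le>h. q ^ y) * F (Suc h) + (\<Sum>y<h. q ^ y) * F (h - 1))" for h
  proof (cases h)
    case 0
    have "F 0 = 1 + l * (1 - q ^ Suc 0) * l ^ Suc 0 * S (Suc 0)"
      using suminf_secant_summand_0[OF q w]
      by (simp add: F_def S_def power2_eq_square algebra_simps)
    then show ?thesis
      unfolding step[symmetric] using 0 by simp
  next
    case (Suc k)
    have "F (Suc k) = l ^ Suc k * ((1 + l\<^sup>2) * S (Suc k))"
      by (simp add: F_def)
    also have "\<dots> = l ^ Suc k * (l\<^sup>2 * (1 - q ^ Suc (Suc k)) * S (Suc (Suc k))
        + (1 - q ^ Suc k) * S k)"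
      unfolding S_def suminf_secant_summand_Suc[OF q w] ..
    also have "\<dots> = l * (1 - q ^ Suc (Suc k)) * l ^ Suc (Suc k) * S (Suc (Suc k))
        + l * (1 - q ^ Suc k) * l ^ k * S k"
      by (simp add: power2_eq_square algebra_simps)
    finally show ?thesis
      unfolding step[symmetric] using Suc by (simp only: distrib_left lessThan_Suc_atMost) simp
  qed
  \<comment> \<open>The decay \<open>(1 / 4) ^ h\<close> of \<open>l ^ h\<close> offsets the growth
    \<open>4 ^ h\<close> of the bound on \<open>S h\<close>.\<close>
  have "norm (F h) \<le> 8" for h
  proof -
    have "norm (1 + l\<^sup>2) \<le> 1 + (1 / 4)\<^sup>2"
      using l by (intro norm_triangle_le) (simp add: norm_power power_mono)
    also have "\<dots> \<le> 2" by (simp add: power2_eq_square)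
    finally have "norm (F h) \<le> 2 * (1 / 4) ^ h * (4 * 4 ^ h)"
      unfolding F_def norm_mult norm_power S_def
      using norm_suminf_secant_summand_le[OF q w] l by (intro mult_mono power_mono) auto
    also have "\<dots> = 8" by (simp add: power_divide)
    finally show ?thesis .
  qed
  from bounded_solution_sums[OF q t rec this, of 0] show ?thesis
    by (simp add: F_def S_def)
qed

text \<open>The roots have product 1, and \<open>norm c > 2\<close> keeps them off the unit circle.
  Hence exactly one root lies inside the unit disc, and it is the one of smallest modulus.\<close>

lemma is_arg_min_quadratic_root:
  fixes c :: complex
  assumes c: "norm c > 2"
  defines "P \<equiv> \<lambda>z. z\<^sup>2 - z * c + 1 = 0"
  shows "is_arg_min norm P l \<longleftrightarrow> P l \<and> norm l < 1"
    and "\<exists>!l. is_arg_min norm P l"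
proof -
  have nz: "z \<noteq> 0" if "P z" for z using that by (auto simp: P_def)
  have inv: "P (inverse z)" if "P z" for z
    using that nz[OF that] by (simp add: P_def field_simps power2_eq_square)
  have other: "y = z \<or> y = inverse z" if "P y" "P z" for y z
  proof -
    \<comment> \<open>Eliminating \<open>c\<close> between the two equations gives this
      factorization.\<close>
    have "(y - z) * (y * z - 1) = 0" using that unfolding P_def by algebra
    then have "y = z \<or> z * y = 1" by (simp only: mult_eq_0_iff right_minus_eq mult.commute)
    then show ?thesis by (metis inverse_unique)
  qed
  have ne1: "norm z \<noteq> 1" if "P z" for z
  proof
    assume z: "norm z = 1"
    have "z * c = z\<^sup>2 + 1" using that by (simp add: P_def algebra_simps)
    then have "norm (z * c) \<le> norm (z\<^sup>2) + norm (1::complex)" by (metis norm_triangle_ineq)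
    then show False using c z by (simp add: norm_mult norm_power)
  qed
  show iff: "is_arg_min norm P l \<longleftrightarrow> P l \<and> norm l < 1" for l
  proof
    assume l: "is_arg_min norm P l"
    then have Pl: "P l" by (simp add: is_arg_min_def)
    then have "norm l \<le> inverse (norm l)"
      using l inv[OF Pl] by (auto simp: is_arg_min_def norm_inverse not_less)
    then have "\<not> norm l > 1" using one_less_inverse_iff[of "inverse (norm l)"] by force
    then show "P l \<and> norm l < 1" using Pl ne1[OF Pl] by linarith
  next
    assume l: "P l \<and> norm l < 1"
    have "norm l \<le> norm y" if "P y" for y
    proof -
      have "1 \<le> inverse (norm l)" using l nz by (intro one_le_inverse) auto
      then show ?thesis using other[OF that, of l] l by (auto simp: norm_inverse)
    qed
    then show "is_arg_min norm P l" using l by (auto simp: is_arg_min_def not_less)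
  qed
  have "P ((c + csqrt (c\<^sup>2 - 4)) / 2)"
  proof -
    have root: "((c + d) / 2)\<^sup>2 - (c + d) / 2 * c + 1 = (d\<^sup>2 - (c\<^sup>2 - 4)) / 4" for d
      by (simp add: field_simps power2_eq_square)
    show ?thesis unfolding P_def root by simp
  qed
  then obtain z where z: "P z" by blast
  have "\<exists>l. P l \<and> norm l < 1"
  proof (cases "norm z < 1")
    case False
    then have "norm (inverse z) < 1"
      using ne1[OF z] by (simp add: norm_inverse inverse_less_1_iff)
    then show ?thesis using inv[OF z] by blast
  qed (use z in blast)
  moreover have "y = l" if "P y" "norm y < 1" "P l" "norm l < 1" for y l
  proof (rule ccontr)
    assume "y \<noteq> l"
    then have "norm y = inverse (norm l)" using other[OF that(1,3)] by (simp add: norm_inverse)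
    moreover have "1 \<le> inverse (norm l)" using that nz by (intro one_le_inverse) auto
    ultimately show False using that by simp
  qed
  ultimately show "\<exists>!l. is_arg_min norm P l" unfolding iff by blast
qed

theorem corollary1p6:
  fixes q :: complex
  assumes "norm q < 1"
  shows "\<exists>r>0. \<forall>t. t \<noteq> 0 \<and> norm t < r \<longrightarrow>
    secant_gf_term t q summable_on UNIV \<and>
    (\<exists>!l. is_arg_min norm (\<lambda>z. z\<^sup>2 - z * (1 - q) / t + 1 = 0) l) \<and>
    (\<forall>l sqrtq. is_arg_min norm (\<lambda>z. z\<^sup>2 - z * (1 - q) / t + 1 = 0) l \<and> sqrtq\<^sup>2 = q \<longrightarrow>
       (\<forall>k. 1 - \<i> * l * sqrtq * q ^ k \<noteq> 0) \<and>
       summable (\<lambda>k. (- \<i> * l * sqrtq) ^ k / (1 - \<i> * l * sqrtq * q ^ k)) \<and>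
       secant_gf t q =
         (1 + l\<^sup>2) * (\<Sum>k. (- \<i> * l * sqrtq) ^ k / (1 - \<i> * l * sqrtq * q ^ k)))"
proof (intro exI[of _ "(1 - norm q) / 16"] conjI allI impI; (elim conjE)?)
  show "(1 - norm q) / 16 > 0" using assms by simp
next
  fix t :: complex
  assume t0: "t \<noteq> 0" and t: "norm t < (1 - norm q) / 16"
  \<comment> \<open>The radius is chosen so that \<open>norm (1 - q) \<ge> 1 - norm q\<close> yields
    \<open>norm c > 16\<close>, which makes \<open>l\<close> small enough, and so that the
    contraction factor is below 1.\<close>
  define c where "c = (1 - q) / t"
  have c: "norm c > 16"
  proof -
    have "16 * norm t < norm (1 - q)"
      using t norm_triangle_ineq2[of 1 q] by simp
    then show ?thesis using t0 by (simp add: c_def norm_divide field_simps)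
  qed
  have c_eq: "z * (1 - q) / t = z * c" for z by (simp add: c_def)
  have t': "2 * norm t / (1 - norm q) < 1" using t assms by (simp add: field_simps)
  show unique: "\<exists>!l. is_arg_min norm (\<lambda>z. z\<^sup>2 - z * (1 - q) / t + 1 = 0) l"
    unfolding c_eq using c by (intro is_arg_min_quadratic_root) simp
  \<comment> \<open>Any square root \<open>s\<close> of \<open>q\<close> will do, as only the norm
    and the square of \<open>\<i> * l * s\<close> enter.\<close>
  have main: "norm (\<i> * l * s) \<le> 1 / 2 \<and> (\<i> * l * s)\<^sup>2 = - (l\<^sup>2 * q) \<and>
      (secant_gf_term t q has_sum ((1 + l\<^sup>2) * suminf (secant_summand q (\<i> * l * s) 0))) UNIV"
    if l: "is_arg_min norm (\<lambda>z. z\<^sup>2 - z * (1 - q) / t + 1 = 0) l" and s: "s\<^sup>2 = q" for l s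
  proof -
    have root: "l\<^sup>2 - l * c + 1 = 0" and l1: "norm l < 1"
      using l is_arg_min_quadratic_root(1)[of c l] c unfolding c_eq by auto
    have lc: "l * c = 1 + l\<^sup>2" using root by (simp add: algebra_simps)
    \<comment> \<open>Since \<open>l * c = 1 + l\<^sup>2\<close> has norm at most 2, a large
      \<open>c\<close> forces a small \<open>l\<close>.\<close>
    have "norm l * 16 \<le> norm l * norm c" using c by (intro mult_left_mono) auto
    also have "\<dots> \<le> 1 + (norm l)\<^sup>2"
      using norm_triangle_ineq[of 1 "l\<^sup>2"] by (simp add: lc norm_power flip: norm_mult)
    also have "\<dots> \<le> 2" using l1 by (simp add: power_le_one)
    finally have l8: "norm l \<le> 1 / 4" by simp
    have "(norm s)\<^sup>2 < 1" using s assms by (simp flip: norm_power)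
    then have "norm s \<le> 1" by (simp add: power_less_one_iff)
    then have "norm l * norm s \<le> 1 / 4 * 1" using l8 by (intro mult_mono) auto
    then have w: "norm (\<i> * l * s) \<le> 1 / 2" by (simp add: norm_mult)
    have w2: "(\<i> * l * s)\<^sup>2 = - (l\<^sup>2 * q)" by (simp add: power_mult_distrib s)
    have "t * (1 + l\<^sup>2) = l * (1 - q)" unfolding lc[symmetric] using t0 by (simp add: c_def)
    from secant_gf_has_sum[OF assms t' secant_sums[OF assms t' l8 this w w2]] w w2
    show ?thesis by blast
  qed
  show "secant_gf_term t q summable_on UNIV"
  proof -
    from unique obtain l where l: "is_arg_min norm (\<lambda>z. z\<^sup>2 - z * (1 - q) / t + 1 = 0) l" by blast
    have "(csqrt q)\<^sup>2 = q" by simp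
    from main[OF l this] show ?thesis by (auto simp: summable_on_def)
  qed
  fix l s :: complex
  assume "is_arg_min norm (\<lambda>z. z\<^sup>2 - z * (1 - q) / t + 1 = 0) l" and "s\<^sup>2 = q"
  from main[OF this] have w: "norm (\<i> * l * s) \<le> 1 / 2" "(\<i> * l * s)\<^sup>2 = - (l\<^sup>2 * q)"
    and gf: "(secant_gf_term t q has_sum
      ((1 + l\<^sup>2) * suminf (secant_summand q (\<i> * l * s) 0))) UNIV"
    by auto
  \<comment> \<open>At height 0 the numerator is the empty product and the denominator has a single
    factor.\<close>
  have summand: "secant_summand q (\<i> * l * s) 0
      = (\<lambda>k. (- \<i> * l * s) ^ k / (1 - \<i> * l * s * q ^ k))"
    by (simp add: secant_summand_def qpoch_def fun_eq_iff)
  show "1 - \<i> * l * s * q ^ k \<noteq> 0" for k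
    by (rule one_minus_w_power_nonzero[OF assms w])
  show "summable (\<lambda>k. (- \<i> * l * s) ^ k / (1 - \<i> * l * s * q ^ k))"
    using summable_secant_summand[OF assms w, of 0] unfolding summand .
  show "secant_gf t q = (1 + l\<^sup>2) * (\<Sum>k. (- \<i> * l * s) ^ k / (1 - \<i> * l * s * q ^ k))"
    unfolding secant_gf_def using infsumI[OF gf] unfolding summand .
qed

end
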